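(* Let $a,b,c$ be positive integers with $2\leq a\leq b$, and suppose that either $a,b,c$ are all odd, or $a$ and $b$ are both even with $(a,b)\neq(2,2)$ (and $c$ arbitrary). Then there exists a magic rectangle $MR(ac,bc;b,a)$.
   Context: For positive integers $m,n,r,s$ with $mr=ns$, $r\le n$, $s\le m$, a magic rectangle $MR(m,n;r,s)$ is an $m\times n$ array in which some cells may be empty, each row contains exactly $r$ filled cells, each column contains exactly $s$ filled cells, the filled cells contain the numbers $0,1,\ldots,mr-1$, each exactly once, the sum of the entries of each row is the same for all rows, and the sum of the entries of each column is the same for all columns. *)

theory Defs
  imports Main
begin

text \<open>An \<open>m \<times> n\<close> array with possibly empty cells is a function \<open>A\<close>, of which only the cells
  \<open>A i j\<close> with \<open>i < m\<close> and \<open>j < n\<close> matter; \<open>None\<close> marks an empty cell.\<close>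

type_synonym partial_array = "nat \<Rightarrow> nat \<Rightarrow> nat option"

definition filled_cells :: "nat \<Rightarrow> nat \<Rightarrow> partial_array \<Rightarrow> (nat \<times> nat) set" where
  "filled_cells m n A = {(i, j). i < m \<and> j < n \<and> A i j \<noteq> None}"

definition row_filled :: "nat \<Rightarrow> partial_array \<Rightarrow> nat \<Rightarrow> nat set" where
  "row_filled n A i = {j. j < n \<and> A i j \<noteq> None}"

definition col_filled :: "nat \<Rightarrow> partial_array \<Rightarrow> nat \<Rightarrow> nat set" where
  "col_filled m A j = {i. i < m \<and> A i j \<noteq> None}"

definition row_sum :: "nat \<Rightarrow> partial_array \<Rightarrow> nat \<Rightarrow> nat" where
  "row_sum n A i = (\<Sum>j\<in>row_filled n A i. the (A i j))"

definition col_sum :: "nat \<Rightarrow> partial_array \<Rightarrow> nat \<Rightarrow> nat" where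
  "col_sum m A j = (\<Sum>i\<in>col_filled m A j. the (A i j))"

definition magic_rectangle ::
  "nat \<Rightarrow> nat \<Rightarrow> nat \<Rightarrow> nat \<Rightarrow> partial_array \<Rightarrow> bool" where
  "magic_rectangle m n r s A \<longleftrightarrow>
     0 < m \<and> 0 < n \<and> 0 < r \<and> 0 < s \<and> m * r = n * s \<and> r \<le> n \<and> s \<le> m \<and>
     (\<forall>i<m. card (row_filled n A i) = r) \<and>
     (\<forall>j<n. card (col_filled m A j) = s) \<and>
     bij_betw (\<lambda>(i, j). the (A i j)) (filled_cells m n A) {0..<m * r} \<and>
     (\<forall>i<m. \<forall>i'<m. row_sum n A i = row_sum n A i') \<and>
     (\<forall>j<n. \<forall>j'<n. col_sum m A j = col_sum m A j')"

end

theory Submission imports Defs begin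

text \<open>The array consists of \<open>c\<close> full \<open>a \<times> b\<close> blocks on the diagonal. Entries are centred at
  \<open>0\<close>, so that all row and column sums have to vanish. It suffices to have a single centred magic
  rectangle \<open>x\<close>: the \<open>k\<close>-th block has the entries \<open>c x\<^sub>i\<^sub>j + K\<^sub>i\<^sub>j(k)\<close>, where each \<open>K\<^sub>i\<^sub>j\<close>
  enumerates the centred range of length \<open>c\<close> and \<open>K(k)\<close> has zero row and column sums. The matrix
  \<open>K\<close> is a checkerboard of signs, apart from its first three rows and columns in the odd case, where
  three permutations with sum \<open>0\<close> are used.

  The single rectangle is glued from strips of two rows, or of two columns, of the form
  \<open>(x\<^sub>j, - x\<^sub>j)\<close> with \<open>\<Sum>x\<^sub>j = 0\<close>. Such a strip is given by a set of positive numbers that splits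
  into two parts of equal sum, for instance \<open>w, w + 3\<close> and \<open>w + 1, w + 2\<close>. In the odd case one starts
  with a core of size \<open>3 \<times> 3\<close>, \<open>3 \<times> 5\<close> or \<open>3 \<times> 7\<close>, widens it to \<open>3 \<times> b\<close> by triples
  \<open>{d, P, P + d}\<close>, and adds strips of length \<open>b\<close> made of one triple (or a quintuple) and quadruples
  of consecutive numbers.\<close>

section \<open>Gluing arrays with zero line sums\<close>

text \<open>The value set \<open>S\<close> is arbitrary, so that arrays on disjoint sets can be
  glued.\<close>

definition zero_rect :: "nat \<Rightarrow> nat \<Rightarrow> int set \<Rightarrow> bool" where
  "zero_rect a b S \<longleftrightarrow> (\<exists>A. bij_betw (\<lambda>(i, j). A i j) ({..<a} \<times> {..<b}) S \<and>
     (\<forall>i<a. (\<Sum>j<b. A i j) = 0) \<and> (\<forall>j<b. (\<Sum>i<a. A i j) = 0))"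

definition pm :: "nat set \<Rightarrow> int set" where
  "pm X = int ` X \<union> (\<lambda>x. - int x) ` X"

definition balanced :: "nat \<Rightarrow> nat set \<Rightarrow> bool" where
  "balanced b Y \<longleftrightarrow> finite Y \<and> card Y = b \<and> 0 \<notin> Y \<and> (\<exists>Z\<subseteq>Y. \<Sum>Z = \<Sum>(Y - Z))"

text \<open>Built one part at a time, so that each part can be turned into a strip by rule
  induction. For \<open>b = 0\<close> it allows \<open>k\<close> empty parts, a starting point used
  later.\<close>

inductive balanced_parts :: "nat \<Rightarrow> nat \<Rightarrow> nat set \<Rightarrow> bool" for b where
  empty: "balanced_parts b 0 {}"
| insert: "balanced_parts b k X \<Longrightarrow> balanced b Y \<Longrightarrow> X \<inter> Y = {} \<Longrightarrow> balanced_parts b (Suc k) (X \<union> Y)"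

lemma sum_lessThan_add:
  fixes f :: "nat \<Rightarrow> 'a::comm_monoid_add"
  shows "(\<Sum>j<n + k. f j) = (\<Sum>j<n. f j) + (\<Sum>j<k. f (n + j))"
  by (induction k) (simp_all add: add_ac)

lemma sum_atLeastLessThan_add:
  fixes f :: "nat \<Rightarrow> 'a::comm_monoid_add"
  shows "(\<Sum>j\<in>{m..<m + n}. f j) = (\<Sum>j<n. f (m + j))"
  by (induction n) simp_all

lemma mem_pm_iff: "z \<in> pm X \<longleftrightarrow> nat \<bar>z\<bar> \<in> X"
proof
  assume "nat \<bar>z\<bar> \<in> X"
  moreover have "z = int (nat \<bar>z\<bar>) \<or> z = - int (nat \<bar>z\<bar>)" by linarith
  ultimately show "z \<in> pm X" unfolding pm_def by blast
qed (auto simp: pm_def)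

lemma pm_Un: "pm (X \<union> Y) = pm X \<union> pm Y"
  by (auto simp: mem_pm_iff)

lemma pm_disjoint: "X \<inter> Y = {} \<Longrightarrow> pm X \<inter> pm Y = {}"
  by (auto simp: mem_pm_iff)

lemma zero_rect_card:
  assumes "zero_rect a b S"
  shows "finite S" "card S = a * b"
proof -
  obtain A where A: "bij_betw (\<lambda>(i, j). A i j) ({..<a} \<times> {..<b}) S"
    using assms unfolding zero_rect_def by metis
  show "finite S" using bij_betw_finite[OF A] by simp
  show "card S = a * b" using bij_betw_same_card[OF A] by (simp add: card_cartesian_product)
qed

lemma zero_rect_transpose:
  assumes "zero_rect a b S"
  shows "zero_rect b a S"
proof -
  obtain A where A: "bij_betw (\<lambda>(i, j). A i j) ({..<a} \<times> {..<b}) S"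
    "\<forall>i<a. (\<Sum>j<b. A i j) = 0" "\<forall>j<b. (\<Sum>i<a. A i j) = 0"
    using assms unfolding zero_rect_def by metis
  have "bij_betw prod.swap ({..<b} \<times> {..<a}) ({..<a} \<times> {..<b})"
    by (rule bij_betw_byWitness[where f' = prod.swap]) auto
  then have "bij_betw ((\<lambda>(i, j). A i j) \<circ> prod.swap) ({..<b} \<times> {..<a}) S"
    using A(1) by (rule bij_betw_trans)
  then have "bij_betw (\<lambda>(j, i). A i j) ({..<b} \<times> {..<a}) S"
    by (simp add: o_def case_prod_unfold)
  then show ?thesis unfolding zero_rect_def using A(2,3) by blast
qed

lemma zero_rect_stack:
  assumes "zero_rect a b S" "zero_rect a' b S'" "S \<inter> S' = {}"
  shows "zero_rect (a + a') b (S \<union> S')"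
proof -
  obtain A where A: "bij_betw (\<lambda>(i, j). A i j) ({..<a} \<times> {..<b}) S"
    "\<forall>i<a. (\<Sum>j<b. A i j) = 0" "\<forall>j<b. (\<Sum>i<a. A i j) = 0"
    using assms(1) unfolding zero_rect_def by metis
  obtain B where B: "bij_betw (\<lambda>(i, j). B i j) ({..<a'} \<times> {..<b}) S'"
    "\<forall>i<a'. (\<Sum>j<b. B i j) = 0" "\<forall>j<b. (\<Sum>i<a'. B i j) = 0"
    using assms(2) unfolding zero_rect_def by metis
  define D where "D i j = (if i < a then A i j else B (i - a) j)" for i j
  have 1: "bij_betw (\<lambda>(i, j). D i j) ({..<a} \<times> {..<b}) S"
    using A(1) by (rule bij_betw_cong[THEN iffD1, rotated]) (auto simp: D_def)
  have shift: "bij_betw (\<lambda>(i, j). (i - a, j)) ({a..<a + a'} \<times> {..<b}) ({..<a'} \<times> {..<b})"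
    by (rule bij_betw_byWitness[where f' = "\<lambda>(i, j). (i + a, j)"]) auto
  have 2: "bij_betw (\<lambda>(i, j). D i j) ({a..<a + a'} \<times> {..<b}) S'"
    using bij_betw_trans[OF shift B(1)]
    by (rule bij_betw_cong[THEN iffD1, rotated]) (auto simp: D_def)
  have "{..<a} \<times> {..<b} \<union> {a..<a + a'} \<times> {..<b} = {..<a + a'} \<times> {..<b}" by auto
  then have bij: "bij_betw (\<lambda>(i, j). D i j) ({..<a + a'} \<times> {..<b}) (S \<union> S')"
    using bij_betw_combine[OF 1 2 assms(3)] by simp
  have "(\<Sum>j<b. D i j) = 0" if "i < a + a'" for i
    using that A(2) B(2) by (cases "i < a") (auto simp: D_def)
  moreover have "(\<Sum>i<a + a'. D i j) = 0" if "j < b" for j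
    using that A(3) B(3) by (simp add: sum_lessThan_add D_def)
  ultimately show ?thesis unfolding zero_rect_def using bij by blast
qed

text \<open>Signs \<open>+\<close> on \<open>Z\<close> and \<open>-\<close> on the rest make the
  first row sum to 0, and the second row is its negative. As 0 is not in \<open>Y\<close>, an entry
  never equals the one below it.\<close>

lemma balanced_strip:
  assumes "balanced b Y"
  shows "zero_rect 2 b (pm Y)"
proof -
  obtain Z where Y: "finite Y" "card Y = b" "0 \<notin> Y" and Z: "Z \<subseteq> Y" "\<Sum>Z = \<Sum>(Y - Z)"
    using assms unfolding balanced_def by blast
  obtain h where h: "bij_betw h {..<b} Y"
    using ex_bij_betw_nat_finite[OF Y(1)] Y(2) by (metis atLeast0LessThan)
  define x where "x j = (if h j \<in> Z then int (h j) else - int (h j))" for j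
  define A where "A i j = (if i = 0 then x j else - x j)" for i :: nat and j
  have abs_x: "\<bar>x j\<bar> = int (h j)" for j by (simp add: x_def)
  have "(\<Sum>j<b. x j) = (\<Sum>y\<in>Y. if y \<in> Z then int y else - int y)"
    unfolding x_def by (rule sum.reindex_bij_betw[OF h])
  also have "\<dots> = (\<Sum>y\<in>Z. int y) + (\<Sum>y\<in>Y - Z. - int y)"
    using Y(1) Z(1) by (subst sum.subset_diff[of Z]) (auto intro!: sum.cong simp: add.commute)
  also have "\<dots> = int (\<Sum>Z) - int (\<Sum>(Y - Z))" by (simp add: sum_negf)
  finally have sum_x: "(\<Sum>j<b. x j) = 0" using Z(2) by simp
  have h_pos: "h j \<noteq> 0" if "j < b" for j
    using Y(3) bij_betwE[OF h] that by (metis lessThan_iff)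
  have h_inj: "j = j'" if "h j = h j'" "j < b" "j' < b" for j j'
    using inj_onD[OF bij_betw_imp_inj_on[OF h]] that by simp
  have inj: "inj_on (\<lambda>(i, j). A i j) ({..<2} \<times> {..<b})"
  proof (rule inj_onI, clarsimp)
    fix i j i' j'
    assume *: "i < 2" "j < b" "i' < 2" "j' < b" "A i j = A i' j'"
    have "\<bar>A i j\<bar> = int (h j)" "\<bar>A i' j'\<bar> = int (h j')" by (auto simp: A_def abs_x)
    then have jj: "j = j'" using * h_inj by simp
    have "x j \<noteq> 0" using abs_x[of j] h_pos[of j] *(2) by linarith
    then have "i = 0 \<longleftrightarrow> i' = 0" using *(5) jj by (auto simp: A_def split: if_splits)
    then show "i = i' \<and> j = j'" using jj *(1,3) by auto
  qed
  have "(\<lambda>(i, j). A i j) ` ({..<2} \<times> {..<b}) = pm Y"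
  proof -
    have "(\<lambda>(i, j). A i j) ` ({..<2} \<times> {..<b}) = (\<Union>i\<in>{..<2}. A i ` {..<b})" by auto
    also have "\<dots> = (\<Union>j\<in>{..<b}. {x j, - x j})"
      by (auto simp: A_def numeral_2_eq_2 lessThan_Suc)
    also have "\<dots> = (\<Union>j\<in>{..<b}. {int (h j), - int (h j)})"
      by (intro SUP_cong) (auto simp: x_def)
    also have "\<dots> = pm (h ` {..<b})" by (auto simp: pm_def)
    finally show ?thesis using bij_betw_imp_surj_on[OF h] by simp
  qed
  with inj have "bij_betw (\<lambda>(i, j). A i j) ({..<2} \<times> {..<b}) (pm Y)"
    by (simp add: bij_betw_def)
  moreover have "\<forall>i<2. (\<Sum>j<b. A i j) = 0"
  proof (intro allI impI)
    fix i :: nat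
    show "(\<Sum>j<b. A i j) = 0" using sum_x by (cases "i = 0") (simp_all add: A_def sum_negf)
  qed
  moreover have "\<forall>j<b. (\<Sum>i<2. A i j) = 0"
    by (simp add: A_def numeral_2_eq_2)
  ultimately show ?thesis unfolding zero_rect_def by blast
qed

lemma zero_rect_add_strips:
  assumes "balanced_parts b k X" "zero_rect a b S" "S \<inter> pm X = {}"
  shows "zero_rect (a + 2 * k) b (S \<union> pm X)"
  using assms
proof (induction rule: balanced_parts.induct)
  case empty
  then show ?case by (simp add: pm_def)
next
  case (insert k X Y)
  have "pm X \<inter> pm Y = {}"
    using insert.hyps(3) by (rule pm_disjoint)
  then have "zero_rect (a + 2 * k + 2) b ((S \<union> pm X) \<union> pm Y)"
    using insert.IH insert.prems insert.hyps(2)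
    by (intro zero_rect_stack[of "a + 2 * k"] balanced_strip) (auto simp: pm_Un)
  then show ?case by (simp add: pm_Un Un_assoc algebra_simps)
qed

section \<open>Building families of balanced sets\<close>

lemma balanced_Un:
  assumes "balanced b X" "balanced c Y" "X \<inter> Y = {}"
  shows "balanced (b + c) (X \<union> Y)"
proof -
  obtain Z where Z: "Z \<subseteq> X" "\<Sum>Z = \<Sum>(X - Z)" using assms unfolding balanced_def by blast
  obtain W where W: "W \<subseteq> Y" "\<Sum>W = \<Sum>(Y - W)" using assms unfolding balanced_def by blast
  have fin: "finite X" "finite Y" using assms by (auto simp: balanced_def)
  have "\<Sum>(Z \<union> W) = \<Sum>Z + \<Sum>W"
    using Z(1) W(1) fin assms(3) by (intro sum.union_disjoint) (auto intro: finite_subset)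
  also have "\<dots> = \<Sum>((X - Z) \<union> (Y - W))"
    using Z W fin assms(3) by (subst sum.union_disjoint) (auto intro: finite_subset)
  also have "(X - Z) \<union> (Y - W) = X \<union> Y - (Z \<union> W)" using Z(1) W(1) assms(3) by auto
  finally show ?thesis
    using assms Z(1) W(1) fin unfolding balanced_def
    by (auto simp: card_Un_disjoint intro!: exI[of _ "Z \<union> W"])
qed

lemma balanced_parts_UN:
  assumes "finite I" "\<And>i. i \<in> I \<Longrightarrow> balanced b (F i)"
    "\<And>i j. i \<in> I \<Longrightarrow> j \<in> I \<Longrightarrow> i \<noteq> j \<Longrightarrow> F i \<inter> F j = {}"
  shows "balanced_parts b (card I) (\<Union>i\<in>I. F i)"
  using assms
proof (induction rule: finite_induct)
  case empty
  then show ?case by (simp add: balanced_parts.empty)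
next
  case (insert x I)
  have "(\<Union>i\<in>I. F i) \<inter> F x = {}" using insert by fastforce
  then have "balanced_parts b (Suc (card I)) ((\<Union>i\<in>I. F i) \<union> F x)"
    using insert by (intro balanced_parts.insert) auto
  then show ?case using insert by (simp add: Un_commute)
qed

lemma balanced_triple:
  assumes "0 < d" "d < P"
  shows "balanced 3 {d, P, P + d}"
proof -
  have "{d, P, P + d} - {P + d} = {d, P}" using assms by auto
  then have "\<Sum>{P + d} = \<Sum>({d, P, P + d} - {P + d})" using assms by simp
  moreover have "card {d, P, P + d} = 3" using assms by simp
  ultimately show ?thesis
    using assms unfolding balanced_def by (intro conjI exI[of _ "{P + d}"]) auto
qed

text \<open>In four consecutive terms the outer two and the inner two have equal sums. Odd numbers
  (\<open>u = 2\<close>, \<open>v = 1\<close>) serve the even case, intervals (\<open>u = 1\<close>,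
  \<open>v = 0\<close>) the odd case.\<close>

lemma balanced_progression:
  assumes "0 < u" "0 < u * s + v"
  shows "balanced (4 * q) ((\<lambda>i. u * i + v) ` {s..<s + 4 * q})"
proof (induction q)
  case 0
  then show ?case by (auto simp: balanced_def)
next
  case (Suc q)
  let ?f = "\<lambda>i. u * i + v" and ?w = "u * (s + 4 * q) + v"
  let ?B = "{?w, ?w + u, ?w + 2 * u, ?w + 3 * u}"
  have "?B - {?w, ?w + 3 * u} = {?w + u, ?w + 2 * u}" using assms(1) by auto
  then have "\<Sum>{?w, ?w + 3 * u} = \<Sum>(?B - {?w, ?w + 3 * u})" using assms(1) by simp
  moreover have "card ?B = 4" using assms(1) by simp
  moreover have "0 < ?w" using assms by auto
  ultimately have B: "balanced 4 ?B"
    unfolding balanced_def by (intro conjI exI[of _ "{?w, ?w + 3 * u}"]) auto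
  have im: "?f ` {s + 4 * q..<s + 4 * Suc q} = ?B"
    by (simp add: eval_nat_numeral atLeastLessThanSuc algebra_simps insert_commute)
  have "inj ?f" using assms(1) by (auto intro: injI)
  then have "?f ` {s..<s + 4 * q} \<inter> ?B = {}"
    unfolding im[symmetric] by (subst image_Int[symmetric]) auto
  moreover have "?f ` {s..<s + 4 * Suc q} = ?f ` {s..<s + 4 * q} \<union> ?B"
    unfolding im[symmetric] image_Un[symmetric] by (rule arg_cong[where f = "image ?f"]) auto
  ultimately show ?case using balanced_Un[OF Suc B] by (simp add: add.commute)
qed

text \<open>The new terms are dealt out in runs of \<open>4 * q\<close>, one run to each part.
  Widths therefore matter only modulo 4.\<close>

lemma balanced_parts_extend:
  assumes "balanced_parts b k X" "0 < u" "0 < u * s + v"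
    "X \<inter> (\<lambda>i. u * i + v) ` {s..<s + 4 * q * k} = {}"
  shows "balanced_parts (b + 4 * q) k (X \<union> (\<lambda>i. u * i + v) ` {s..<s + 4 * q * k})"
  using assms
proof (induction rule: balanced_parts.induct)
  case empty
  then show ?case by (simp add: balanced_parts.empty)
next
  case (insert k X Y)
  let ?f = "\<lambda>i. u * i + v" and ?w = "s + 4 * q * k"
  have "{s..<s + 4 * q * Suc k} = {s..<?w} \<union> {?w..<?w + 4 * q}" by auto
  then have split: "?f ` {s..<s + 4 * q * Suc k} = ?f ` {s..<?w} \<union> ?f ` {?w..<?w + 4 * q}"
    by (simp only: image_Un)
  have disj: "(X \<union> Y) \<inter> (?f ` {s..<?w} \<union> ?f ` {?w..<?w + 4 * q}) = {}"
    using insert.prems(3) unfolding split .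
  have "inj ?f" using assms(2) by (auto intro: injI)
  then have disj': "?f ` {s..<?w} \<inter> ?f ` {?w..<?w + 4 * q} = {}"
    by (subst image_Int[symmetric]) auto
  have "0 < u * ?w + v" using insert.prems(1,2) by auto
  then have "balanced_parts (b + 4 * q) (Suc k) ((X \<union> ?f ` {s..<?w}) \<union> (Y \<union> ?f ` {?w..<?w + 4 * q}))"
    using disj disj' insert.hyps insert.prems(1,2)
    by (intro balanced_parts.insert insert.IH balanced_Un balanced_progression) auto
  then show ?case unfolding split by (simp add: Un_ac)
qed

section \<open>From one block to \<open>c\<close> blocks\<close>

text \<open>The numbers \<open>2 v - (N - 1)\<close> for \<open>v < N\<close>: doubling avoids half-integers when \<open>N\<close> is even.\<close>

definition cent :: "nat \<Rightarrow> int set" where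
  "cent N = {x. \<bar>x\<bar> < int N \<and> odd (x + int N)}"

lemma cent_bij: "bij_betw (\<lambda>x. nat ((x + int N - 1) div 2)) (cent N) {..<N}"
  by (rule bij_betw_byWitness[where f' = "\<lambda>v. 2 * int v - (int N - 1)"])
    (auto simp: cent_def elim!: oddE)

lemma cent_card: "finite (cent N)" "card (cent N) = N"
  using bij_betw_finite[OF cent_bij[of N]] bij_betw_same_card[OF cent_bij[of N]] by auto

text \<open>Counting replaces every surjectivity proof.\<close>

lemma bij_betw_centI:
  assumes "inj_on f S" "\<And>x. x \<in> S \<Longrightarrow> f x \<in> cent N" "card S = N"
  shows "bij_betw f S (cent N)"
  using assms card_image[OF assms(1)] cent_card[of N]
  by (metis bij_betw_def card_subset_eq image_subsetI)

text \<open>Block \<open>k\<close> sits at the \<open>k\<close>-th diagonal position. A centred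
  entry \<open>x\<close> stands for the number \<open>(x + N - 1) / 2\<close>, so zero line sums
  become the constants \<open>b * (N - 1) / 2\<close> and \<open>a * (N - 1) / 2\<close>.\<close>

lemma magic_rectangle_of_family:
  fixes V :: "nat \<Rightarrow> nat \<Rightarrow> nat \<Rightarrow> int"
  assumes pos: "0 < a" "0 < b" "0 < c"
    and bij: "bij_betw (\<lambda>(k, i, j). V k i j) ({..<c} \<times> {..<a} \<times> {..<b}) (cent (a * b * c))"
    and rows: "\<And>k i. k < c \<Longrightarrow> i < a \<Longrightarrow> (\<Sum>j<b. V k i j) = 0"
    and cols: "\<And>k j. k < c \<Longrightarrow> j < b \<Longrightarrow> (\<Sum>i<a. V k i j) = 0"
  shows "\<exists>A. magic_rectangle (a * c) (b * c) b a A"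
proof -
  define N where "N = a * b * c"
  define g where "g x = nat ((x + int N - 1) div 2)" for x
  define A where "A I J = (if I div a = J div b then Some (g (V (I div a) (I mod a) (J mod b))) else None)" for I J
  have g: "2 * int (g x) = x + (int N - 1)" if "x \<in> cent N" for x
    using that by (auto simp: g_def cent_def elim!: oddE)
  have V: "V k i j \<in> cent N" if "k < c" "i < a" "j < b" for k i j
    using bij_betwE[OF bij] that unfolding N_def by fastforce
  have less: "n * k + i < n * c" if "k < c" "i < n" for n k i :: nat
  proof -
    have "n * k + i < n * Suc k" using that by simp
    also have "\<dots> \<le> n * c" using that by (intro mult_le_mono2) simp
    finally show ?thesis .
  qed
  have block: "J div n = k \<longleftrightarrow> n * k \<le> J \<and> J < n * k + n" if "0 < n" for J n k :: nat
    using that dividend_less_times_div[of n J] div_nat_eqI[of n k J]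
    by (auto simp: add.commute)
  have row: "row_filled (b * c) A I = {b * (I div a)..<b * (I div a) + b}" if "I < a * c" for I
  proof -
    have k: "I div a < c" using that by (simp add: less_mult_imp_div_less mult.commute)
    \<comment> \<open>Even the last column of the block, at offset \<open>b - 1\<close>, lies inside
      the array.\<close>
    have "J < b * c" if "J < b * (I div a) + b" for J
      using that less[of "I div a" "b - 1" b] k pos by linarith
    moreover have "J \<in> row_filled (b * c) A I \<longleftrightarrow> J < b * c \<and> J div b = I div a" for J
      by (auto simp: row_filled_def A_def)
    ultimately show ?thesis unfolding block[OF pos(2)] by (intro set_eqI) auto
  qed
  have col: "col_filled (a * c) A J = {a * (J div b)..<a * (J div b) + a}" if "J < b * c" for J
  proof -
    have k: "J div b < c" using that by (simp add: less_mult_imp_div_less mult.commute)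
    have "I < a * c" if "I < a * (J div b) + a" for I
      using that less[of "J div b" "a - 1" a] k pos by linarith
    moreover have "I \<in> col_filled (a * c) A J \<longleftrightarrow> I < a * c \<and> I div a = J div b" for I
      by (auto simp: col_filled_def A_def)
    ultimately show ?thesis unfolding block[OF pos(1)] by (intro set_eqI) auto
  qed
  have row_sum: "2 * int (row_sum (b * c) A I) = int b * (int N - 1)" if I: "I < a * c" for I
  proof -
    let ?k = "I div a" and ?i = "I mod a"
    have k: "?k < c" "?i < a" using I pos by (simp_all add: less_mult_imp_div_less mult.commute)
    have "row_sum (b * c) A I = (\<Sum>j<b. the (A I (b * ?k + j)))"
      unfolding row_sum_def row[OF I] by (rule sum_atLeastLessThan_add)
    also have "\<dots> = (\<Sum>j<b. g (V ?k ?i j))"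
      by (intro sum.cong) (auto simp: A_def)
    finally have "2 * int (row_sum (b * c) A I) = (\<Sum>j<b. 2 * int (g (V ?k ?i j)))"
      by (simp add: sum_distrib_left)
    also have "\<dots> = (\<Sum>j<b. V ?k ?i j + (int N - 1))"
      using V k by (intro sum.cong) (auto simp: g)
    also have "\<dots> = int b * (int N - 1)" using rows[OF k] by (simp add: sum.distrib)
    finally show ?thesis .
  qed
  have col_sum: "2 * int (col_sum (a * c) A J) = int a * (int N - 1)" if J: "J < b * c" for J
  proof -
    let ?k = "J div b" and ?j = "J mod b"
    have k: "?k < c" "?j < b" using J pos by (simp_all add: less_mult_imp_div_less mult.commute)
    have "col_sum (a * c) A J = (\<Sum>i<a. the (A (a * ?k + i) J))"
      unfolding col_sum_def col[OF J] by (rule sum_atLeastLessThan_add)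
    also have "\<dots> = (\<Sum>i<a. g (V ?k i ?j))"
      by (intro sum.cong) (auto simp: A_def)
    finally have "2 * int (col_sum (a * c) A J) = (\<Sum>i<a. 2 * int (g (V ?k i ?j)))"
      by (simp add: sum_distrib_left)
    also have "\<dots> = (\<Sum>i<a. V ?k i ?j + (int N - 1))"
      using V k by (intro sum.cong) (auto simp: g)
    also have "\<dots> = int a * (int N - 1)" using cols[OF k] by (simp add: sum.distrib)
    finally show ?thesis .
  qed
  let ?T = "{..<c} \<times> {..<a} \<times> {..<b}"
  have filled: "filled_cells (a * c) (b * c) A = {(I, J). I < a * c \<and> J < b * c \<and> I div a = J div b}"
    by (auto simp: filled_cells_def A_def)
  have div_less: "x div n < c" if "x < n * c" for x n :: nat
    using that by (simp add: less_mult_imp_div_less mult.commute)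
  \<comment> \<open>Block number and position within the block are coordinates on the filled cells,
    which carries bijectivity over from \<open>V\<close> to \<open>A\<close>.\<close>
  have cells: "bij_betw (\<lambda>(k, i, j). (a * k + i, b * k + j)) ?T (filled_cells (a * c) (b * c) A)"
    unfolding filled
  proof (rule bij_betw_byWitness[where f' = "\<lambda>(I, J). (I div a, I mod a, J mod b)"], goal_cases)
    case 1
    show ?case by auto
  next
    case 2
    show ?case by (auto simp del: mult_div_mod_eq) (metis mult_div_mod_eq)+
  next
    case 3
    show ?case by (auto simp: less)
  next
    case 4
    show ?case using pos by (auto simp: div_less)
  qed
  have "bij_betw g (cent N) {..<N}" unfolding g_def by (rule cent_bij)
  with bij[folded N_def] have "bij_betw (g \<circ> (\<lambda>(k, i, j). V k i j)) ?T {..<N}"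
    by (rule bij_betw_trans)
  then have "bij_betw ((\<lambda>(i, j). the (A i j)) \<circ> (\<lambda>(k, i, j). (a * k + i, b * k + j))) ?T {..<N}"
    by (rule bij_betw_cong[THEN iffD1, rotated]) (auto simp: A_def)
  then have bij_A: "bij_betw (\<lambda>(i, j). the (A i j)) (filled_cells (a * c) (b * c) A) {0..<a * c * b}"
    unfolding bij_betw_comp_iff[OF cells, symmetric] N_def
    by (simp add: atLeast0LessThan mult.assoc mult.commute[of b c])
  have "magic_rectangle (a * c) (b * c) b a A"
    unfolding magic_rectangle_def
  proof (intro conjI allI impI bij_A)
    show "row_sum (b * c) A I = row_sum (b * c) A I'" if "I < a * c" "I' < a * c" for I I'
      using row_sum[OF that(1)] row_sum[OF that(2)] by simp
    show "col_sum (a * c) A J = col_sum (a * c) A J'" if "J < b * c" "J' < b * c" for J J'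
      using col_sum[OF that(1)] col_sum[OF that(2)] by simp
  qed (use pos in \<open>simp_all add: row col\<close>)
  then show ?thesis by blast
qed

section \<open>Kernels that vary the entries from block to block\<close>

definition zero_kernel :: "nat \<Rightarrow> nat \<Rightarrow> nat \<Rightarrow> bool" where
  "zero_kernel a b c \<longleftrightarrow> (\<exists>K. (\<forall>i<a. \<forall>j<b. bij_betw (K i j) {..<c} (cent c)) \<and>
     (\<forall>k<c. \<forall>i<a. (\<Sum>j<b. K i j k) = 0) \<and> (\<forall>k<c. \<forall>j<b. (\<Sum>i<a. K i j k) = 0))"

text \<open>In \<open>c * A + K\<close> the array \<open>A\<close> acts as the leading digit and
  \<open>K\<close> as the last digit of an expansion to base \<open>c\<close>; both have zero line
  sums.\<close>

lemma magic_rectangle_of_kernel: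
  assumes pos: "0 < a" "0 < b" "0 < c"
    and "zero_rect a b (cent (a * b))" "zero_kernel a b c"
  shows "\<exists>A. magic_rectangle (a * c) (b * c) b a A"
proof -
  obtain A where A: "bij_betw (\<lambda>(i, j). A i j) ({..<a} \<times> {..<b}) (cent (a * b))"
    "\<forall>i<a. (\<Sum>j<b. A i j) = 0" "\<forall>j<b. (\<Sum>i<a. A i j) = 0"
    using assms(4) unfolding zero_rect_def by metis
  obtain K where K: "\<forall>i<a. \<forall>j<b. bij_betw (K i j) {..<c} (cent c)"
    "\<forall>k<c. \<forall>i<a. (\<Sum>j<b. K i j k) = 0" "\<forall>k<c. \<forall>j<b. (\<Sum>i<a. K i j k) = 0"
    using assms(5) unfolding zero_kernel_def by metis
  define V where "V k i j = int c * A i j + K i j k" for k i j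
  have A_cent: "A i j \<in> cent (a * b)" if "i < a" "j < b" for i j
    using bij_betwE[OF A(1)] that by fastforce
  have K_cent: "K i j k \<in> cent c" if "i < a" "j < b" "k < c" for i j k
    using bij_betwE K(1) that by blast
  have "inj_on (\<lambda>(k, i, j). V k i j) ({..<c} \<times> {..<a} \<times> {..<b})"
  proof (rule inj_onI, clarsimp)
    fix k i j k' i' j'
    assume *: "k < c" "i < a" "j < b" "k' < c" "i' < a" "j' < b" "V k i j = V k' i' j'"
    define u where "u = A i j - A i' j'"
    have y: "int c * u = K i' j' k' - K i j k"
      using *(7) by (simp add: V_def u_def algebra_simps)
    \<comment> \<open>Elements of \<open>cent (a * b)\<close> share their parity, so
      \<open>int c * u\<close> is a multiple of \<open>2 * c\<close>, whereas elements of
      \<open>cent c\<close> differ by less than \<open>2 * c\<close>.\<close>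
    have "even u" using A_cent[of i j] A_cent[of i' j'] * by (auto simp: u_def cent_def)
    then obtain t where t: "u = 2 * t" ..
    have "\<bar>int c * u\<bar> < 2 * int c"
      using K_cent[of i j k] K_cent[of i' j' k'] * unfolding y by (auto simp: cent_def)
    then have "int c * \<bar>t\<bar> < int c * 1" by (simp add: t abs_mult mult.commute)
    then have "t = 0" using mult_less_cancel_left_pos[of "int c"] pos by simp
    with t u_def have "A i j = A i' j'" by simp
    then have ij: "i = i'" "j = j'"
      using inj_onD[OF bij_betw_imp_inj_on[OF A(1)], of "(i, j)" "(i', j')"] * by auto
    then have "K i j k = K i j k'" using y by (simp add: u_def)
    then show "k = k' \<and> i = i' \<and> j = j'"
      using inj_onD[OF bij_betw_imp_inj_on[OF K(1)[rule_format, of i j]], of k k'] ij * by auto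
  qed
  moreover have "V k i j \<in> cent (a * b * c)" if *: "k < c" "i < a" "j < b" for k i j
  proof -
    have "\<bar>A i j\<bar> + 1 \<le> int (a * b)" "\<bar>K i j k\<bar> < int c"
      using A_cent[of i j] K_cent[of i j k] * by (auto simp: cent_def)
    have "\<bar>V k i j\<bar> \<le> int c * \<bar>A i j\<bar> + \<bar>K i j k\<bar>"
      unfolding V_def by (metis abs_mult abs_of_nat abs_triangle_ineq)
    also have "\<dots> < int c * (\<bar>A i j\<bar> + 1)" using \<open>\<bar>K i j k\<bar> < int c\<close> by (simp add: algebra_simps)
    also have "\<dots> \<le> int c * int (a * b)"
      using \<open>\<bar>A i j\<bar> + 1 \<le> int (a * b)\<close> by (intro mult_left_mono) auto
    finally have "\<bar>V k i j\<bar> < int (a * b * c)" by (simp add: mult_ac)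
    moreover have "odd (V k i j + int (a * b * c))"
      using A_cent[of i j] K_cent[of i j k] * by (auto simp: cent_def V_def)
    ultimately show ?thesis by (simp add: cent_def)
  qed
  ultimately have "bij_betw (\<lambda>(k, i, j). V k i j) ({..<c} \<times> {..<a} \<times> {..<b}) (cent (a * b * c))"
    by (intro bij_betw_centI) (auto simp: card_cartesian_product)
  moreover have "(\<Sum>j<b. V k i j) = 0" if "k < c" "i < a" for k i
    using that A(2) K(2) by (simp add: V_def sum.distrib flip: sum_distrib_left)
  moreover have "(\<Sum>i<a. V k i j) = 0" if "k < c" "j < b" for k j
    using that A(3) K(3) by (simp add: V_def sum.distrib flip: sum_distrib_left)
  ultimately show ?thesis using magic_rectangle_of_family[OF pos, of V] by blast
qed

lemma alternating_sum_even: "even n \<Longrightarrow> (\<Sum>j<n. (- 1) ^ j) = (0::int)"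
proof (elim evenE)
  fix m show "n = 2 * m \<Longrightarrow> (\<Sum>j<n. (- 1) ^ j) = (0::int)"
    by (induction m arbitrary: n) auto
qed

lemma bij_betw_cent_sign:
  assumes "bij_betw f {..<c} (cent c)"
  shows "bij_betw (\<lambda>k. (- 1) ^ n * f k) {..<c} (cent c)"
proof (rule bij_betw_centI)
  show "inj_on (\<lambda>k. (- 1) ^ n * f k) {..<c}"
    using bij_betw_imp_inj_on[OF assms] by (auto simp: inj_on_def)
  show "(- 1) ^ n * f k \<in> cent c" if "k \<in> {..<c}" for k
    using bij_betwE[OF assms] that by (cases "even n") (auto simp: cent_def)
qed simp

lemma bij_betw_cent_id: "bij_betw (\<lambda>k. 2 * int k - (int c - 1)) {..<c} (cent c)"
  by (rule bij_betw_centI) (auto simp: inj_on_def cent_def)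

lemma zero_kernel_even:
  assumes "even a" "even b"
  shows "zero_kernel a b c"
  unfolding zero_kernel_def
proof (intro exI[of _ "\<lambda>i j k. (- 1) ^ (i + j) * (2 * int k - (int c - 1))"] conjI allI impI)
  show "bij_betw (\<lambda>k. (- 1) ^ (i + j) * (2 * int k - (int c - 1))) {..<c} (cent c)" for i j
    by (intro bij_betw_cent_sign bij_betw_cent_id)
  show "(\<Sum>j<b. (- 1) ^ (i + j) * (2 * int k - (int c - 1))) = 0" for i k
    using alternating_sum_even[OF assms(2)]
    by (simp add: power_add mult.assoc flip: sum_distrib_left sum_distrib_right)
  show "(\<Sum>i<a. (- 1) ^ (i + j) * (2 * int k - (int c - 1))) = 0" for j k
    using alternating_sum_even[OF assms(1)]
    by (simp add: power_add mult.assoc flip: sum_distrib_left sum_distrib_right)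
qed

text \<open>Lines of odd length cannot be cancelled by signs alone; three of their cells are
  cancelled by these permutations.\<close>

lemma three_zero_sum_permutations:
  assumes "odd c"
  obtains p :: "nat \<Rightarrow> nat \<Rightarrow> int" where "\<And>r. bij_betw (p r) {..<c} (cent c)"
    "\<And>k. p 0 k + p 1 k + p 2 k = 0"
proof -
  obtain h where h: "c = 2 * h + 1" using assms by (auto elim: oddE)
  \<comment> \<open>Modulo \<open>2 * c\<close>, \<open>q\<close> is the identity enumeration
    shifted by \<open>2 * h\<close>; \<open>r\<close> is minus the sum of both. It runs through
    \<open>2 * h\<close>, \<open>2 * h - 4\<close>, ..., \<open>- 2 * h\<close> and then through the
    even numbers skipped in between.\<close>
  define q where "q k = (if k \<le> h then 2 * int k else 2 * int k - 4 * int h - 2)" for k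
  define r where "r k = (if k \<le> h then 2 * int h - 4 * int k else 6 * int h + 2 - 4 * int k)" for k
  have q: "bij_betw q {..<c} (cent c)"
    by (rule bij_betw_centI) (auto simp: inj_on_def q_def cent_def h)
  have r: "bij_betw r {..<c} (cent c)"
  proof (rule bij_betw_centI)
    show "inj_on r {..<c}"
      unfolding inj_on_def r_def by (auto split: if_splits; presburger)
  qed (auto simp: r_def cent_def h)
  show ?thesis
  proof (rule that[of "\<lambda>s. if s = 0 then (\<lambda>k. 2 * int k - (int c - 1)) else if s = 1 then q else r"])
    show "bij_betw (if s = 0 then (\<lambda>k. 2 * int k - (int c - 1)) else if s = 1 then q else r) {..<c} (cent c)" for s :: nat
      using q r bij_betw_cent_id by simp
  qed (simp add: q_def r_def h)
qed

text \<open>The corner is a Latin square in \<open>p 0\<close>, \<open>p 1\<close>,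
  \<open>p 2\<close>. In every line the first three entries cancel, and the remaining even number of
  entries alternate in sign. By symmetry of \<open>K\<close> rows suffice.\<close>

lemma zero_kernel_odd:
  assumes "odd a" "odd b" "odd c" "3 \<le> a" "3 \<le> b"
  shows "zero_kernel a b c"
proof -
  obtain p :: "nat \<Rightarrow> nat \<Rightarrow> int" where p: "\<And>r. bij_betw (p r) {..<c} (cent c)"
    "\<And>k. p 0 k + p 1 k + p 2 k = 0"
    using three_zero_sum_permutations[OF assms(3)] by metis
  define K where "K i j k = (if i < 3 then if j < 3 then p ((i + j) mod 3) k else (- 1) ^ j * p i k
    else if j < 3 then (- 1) ^ i * p j k else (- 1) ^ (i + j) * p 0 k)" for i j k
  have p3: "p (m mod 3) k + p ((m + 1) mod 3) k + p ((m + 2) mod 3) k = 0" for m k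
  proof -
    have "m mod 3 = 0 \<and> (m + 1) mod 3 = 1 \<and> (m + 2) mod 3 = 2
      \<or> m mod 3 = 1 \<and> (m + 1) mod 3 = 2 \<and> (m + 2) mod 3 = 0
      \<or> m mod 3 = 2 \<and> (m + 1) mod 3 = 0 \<and> (m + 2) mod 3 = 1" by presburger
    then show ?thesis using p(2)[of k] by (elim disjE) (simp_all only: add_ac)
  qed
  have sym: "K i j k = K j i k" for i j k by (simp add: K_def add.commute)
  have zero: "(\<Sum>j<n. K i j k) = 0" if n: "odd n" "3 \<le> n" for n i k
  proof -
    obtain m where m: "n = 3 + m" "even m" using n by (metis even_add le_iff_add odd_numeral)
    have 1: "K i 0 k + K i 1 k + K i 2 k = 0"
    proof (cases "i < 3")
      case True
      then show ?thesis using p3[of i k] by (simp add: K_def)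
    next
      case False
      then show ?thesis using p(2)[of k] by (simp add: K_def flip: distrib_left)
    qed
    have 2: "K i (3 + j) k = (- 1) ^ j * K i 3 k" for j
      by (simp add: K_def power_add)
    have "(\<Sum>j<n. K i j k) = (\<Sum>j<3. K i j k) + (\<Sum>j<m. (- 1) ^ j * K i 3 k)"
      unfolding m(1) sum_lessThan_add 2 ..
    also have "\<dots> = 0"
      using 1 alternating_sum_even[OF m(2)] by (simp add: eval_nat_numeral flip: sum_distrib_right)
    finally show ?thesis .
  qed
  have "bij_betw (K i j) {..<c} (cent c)" for i j
    unfolding K_def by (cases "i < 3"; cases "j < 3") (simp_all add: p(1) bij_betw_cent_sign)
  moreover have "(\<Sum>i<a. K i j k) = 0" for j k
    using zero[OF assms(1,4)] by (simp add: sym[of _ j])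
  ultimately show ?thesis
    unfolding zero_kernel_def using zero[OF assms(2,5)] by blast
qed

section \<open>Even side lengths\<close>

text \<open>The array has \<open>a * b\<close> distinct values, as many as
  \<open>cent (a * b)\<close>, so the inclusion is an equality.\<close>

lemma zero_rect_cent_even:
  assumes "zero_rect a b (pm X)" "\<And>x. x \<in> X \<Longrightarrow> odd x \<and> x < a * b" "even (a * b)"
  shows "zero_rect a b (cent (a * b))"
proof -
  have "pm X \<subseteq> cent (a * b)"
    using assms(2,3) by (fastforce simp: pm_def cent_def)
  then have "pm X = cent (a * b)"
    using zero_rect_card[OF assms(1)] cent_card[of "a * b"] by (intro card_subset_eq) auto
  then show ?thesis using assms(1) by simp
qed

text \<open>Six consecutive odd numbers are balanced only at the very beginning (\<open>1 + 3 + 5 + 9 = 7 + 11\<close>);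
  after that, blocks of twelve are cut into two balanced sets of six.\<close>

lemma balanced_parts_six:
  "balanced_parts 6 (2 * t + 1) ((\<lambda>i. 2 * i + 1) ` {0..<12 * t + 6})"
proof (induction t)
  case 0
  have "balanced 6 {1, 3, 5, 7, 9, 11}"
    unfolding balanced_def by (auto intro!: exI[of _ "{7, 11}"] simp: insert_Diff_if)
  then have "balanced_parts 6 (Suc 0) ({} \<union> {1, 3, 5, 7, 9, 11})"
    by (intro balanced_parts.intros) auto
  moreover have "(\<lambda>i. 2 * i + 1) ` {0..<6} = {1, 3, 5, 7, 9, 11::nat}"
    by (simp add: eval_nat_numeral atLeastLessThanSuc insert_commute)
  ultimately show ?case by simp
next
  case (Suc t)
  let ?f = "\<lambda>i. 2 * i + 1 :: nat" and ?w = "24 * t + 13"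
  let ?B = "{?w, ?w + 4, ?w + 12, ?w + 2, ?w + 6, ?w + 8}"
  let ?D = "{?w + 10, ?w + 18, ?w + 22, ?w + 14, ?w + 16, ?w + 20}"
  have "?B - {?w, ?w + 4, ?w + 12} = {?w + 2, ?w + 6, ?w + 8}" by auto
  then have B: "balanced 6 ?B"
    unfolding balanced_def by (intro conjI exI[of _ "{?w, ?w + 4, ?w + 12}"]) auto
  have "?D - {?w + 10, ?w + 18, ?w + 22} = {?w + 14, ?w + 16, ?w + 20}" by auto
  then have D: "balanced 6 ?D"
    unfolding balanced_def by (intro conjI exI[of _ "{?w + 10, ?w + 18, ?w + 22}"]) auto
  have "balanced_parts 6 (Suc (Suc (2 * t + 1))) (?f ` {0..<12 * t + 6} \<union> ?B \<union> ?D)"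
    using B D by (intro balanced_parts.insert Suc) auto
  moreover have "?f ` {0..<12 * Suc t + 6} = ?f ` {0..<12 * t + 6} \<union> (?B \<union> ?D)"
  proof -
    have "{0..<12 * Suc t + 6} = {0..<12 * t + 6} \<union> {12 * t + 6..<12 * Suc t + 6}" by auto
    moreover have "{12 * t + 6..<12 * Suc t + 6} = {12 * t + 6, 12 * t + 7, 12 * t + 8, 12 * t + 9,
        12 * t + 10, 12 * t + 11, 12 * t + 12, 12 * t + 13, 12 * t + 14, 12 * t + 15, 12 * t + 16,
        12 * t + 17}"
      by (intro set_eqI) (simp, presburger)
    then have "?f ` {12 * t + 6..<12 * Suc t + 6} = ?B \<union> ?D"
      by auto
    ultimately show ?thesis by (simp only: image_Un)
  qed
  ultimately show ?case by (simp add: Un_assoc)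
qed

lemma zero_rect_of_parts:
  assumes "balanced_parts b k X"
  shows "zero_rect (2 * k) b (pm X)"
proof -
  have "zero_rect 0 b {}" by (simp add: zero_rect_def bij_betw_def)
  from zero_rect_add_strips[OF assms this] show ?thesis by simp
qed

lemma zero_rect_even_dvd_4: "zero_rect (2 * k) (4 * q) (cent (2 * k * (4 * q)))"
proof -
  \<comment> \<open>The strips start with width 0 and receive quadruples only.\<close>
  have "balanced_parts 0 k {}"
  proof (induction k)
    case (Suc k)
    from balanced_parts.insert[OF Suc, of "{}"] show ?case by (simp add: balanced_def)
  qed (rule balanced_parts.empty)
  from balanced_parts_extend[OF this, of 2 0 1 q]
  have "balanced_parts (4 * q) k ((\<lambda>i. 2 * i + 1) ` {0..<4 * q * k})" by simp
  from zero_rect_of_parts[OF this] show ?thesis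
    by (rule zero_rect_cent_even) (auto simp: mult_ac)
qed

lemma zero_rect_even:
  assumes "even a" "even b" "2 \<le> a" "a \<le> b" "(a, b) \<noteq> (2, 2)"
  shows "zero_rect a b (cent (a * b))"
proof -
  consider "4 dvd b" | "4 dvd a" | "\<not> 4 dvd a" "\<not> 4 dvd b" by blast
  then show ?thesis
  proof cases
    case 1
    then show ?thesis using zero_rect_even_dvd_4 assms(1) by (auto elim!: evenE dvdE)
  next
    case 2
    then have "zero_rect b a (cent (b * a))"
      using zero_rect_even_dvd_4 assms(2) by (auto elim!: evenE dvdE)
    then show ?thesis using zero_rect_transpose by (simp add: mult.commute)
  next
    case 3
    \<comment> \<open>Both sides are 2 modulo 4: there are \<open>2 * t + 1\<close> strips, each
      made of six numbers from \<open>balanced_parts_six\<close> and \<open>q\<close> quadruples.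
      Width 2 would force \<open>a = b = 2\<close>.\<close>
    define t q where "t = a div 4" and "q = (b - 6) div 4"
    have a: "a = 2 * (2 * t + 1)" using 3(1) assms(1) unfolding t_def by presburger
    have "b \<noteq> 2" using assms(3-5) by auto
    then have b: "b = 6 + 4 * q" using 3(2) assms(2-4) unfolding q_def by presburger
    let ?f = "\<lambda>i. 2 * i + 1 :: nat" and ?s = "12 * t + 6" and ?k = "2 * t + 1"
    have "balanced_parts b ?k (?f ` {0..<?s} \<union> ?f ` {?s..<?s + 4 * q * ?k})"
      unfolding b by (intro balanced_parts_extend balanced_parts_six) auto
    from zero_rect_of_parts[OF this] show ?thesis
      unfolding a by (rule zero_rect_cent_even) (auto simp: b algebra_simps)
  qed
qed

section \<open>Odd side lengths\<close>

text \<open>For explicit arrays: injectivity follows from the number of values.\<close>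

lemma zero_rect_of_lists:
  assumes "length L = a" "\<And>r. r \<in> set L \<Longrightarrow> length r = b" "set (concat L) = S" "card S = a * b"
    and rows: "\<And>r. r \<in> set L \<Longrightarrow> sum_list r = 0"
    and cols: "\<And>j. j < b \<Longrightarrow> sum_list (map (\<lambda>r. r ! j) L) = 0"
  shows "zero_rect a b S"
proof -
  have len: "length (L ! i) = b" if "i < a" for i using assms(1,2) that by simp
  have "(\<lambda>(i, j). L ! i ! j) ` ({..<a} \<times> {..<b}) = S"
  proof -
    have "set L = (!) L ` {..<a}" by (auto simp: set_conv_nth assms(1))
    then have "S = (\<Union>i\<in>{..<a}. set (L ! i))" using assms(3) by simp
    also have "\<dots> = (\<Union>i\<in>{..<a}. (\<lambda>j. L ! i ! j) ` {..<b})"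
      by (intro SUP_cong refl) (auto simp: set_conv_nth len)
    finally show ?thesis by auto
  qed
  then have "bij_betw (\<lambda>(i, j). L ! i ! j) ({..<a} \<times> {..<b}) S"
    using assms(4) by (auto simp: bij_betw_def card_cartesian_product intro!: eq_card_imp_inj_on)
  moreover have "(\<Sum>j<b. L ! i ! j) = 0" if "i < a" for i
    using rows[of "L ! i"] that assms(1) by (simp add: sum_list_sum_nth len atLeast0LessThan)
  moreover have "(\<Sum>i<a. L ! i ! j) = 0" if "j < b" for j
    using cols[OF that] assms(1) by (simp add: sum_list_sum_nth atLeast0LessThan)
  ultimately show ?thesis unfolding zero_rect_def by blast
qed

text \<open>Doubling maps the numbers from \<open>- H\<close> to \<open>H\<close> onto
  \<open>cent (a * b)\<close>. By counting, \<open>X\<close> need not be shown to exhaust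
  \<open>{1..H}\<close>.\<close>

lemma zero_rect_cent_odd:
  assumes "zero_rect a b (insert 0 (pm X))" "X \<subseteq> {1..H}" "a * b = 2 * H + 1"
  shows "zero_rect a b (cent (a * b))"
proof -
  let ?S = "insert 0 (pm X)" and ?d = "\<lambda>x::int. 2 * x"
  obtain A where A: "bij_betw (\<lambda>(i, j). A i j) ({..<a} \<times> {..<b}) ?S"
    "\<forall>i<a. (\<Sum>j<b. A i j) = 0" "\<forall>j<b. (\<Sum>i<a. A i j) = 0"
    using assms(1) unfolding zero_rect_def by metis
  have "?d x \<in> cent (a * b)" if "x \<in> ?S" for x
  proof -
    have "x = 0 \<or> nat \<bar>x\<bar> \<in> {1..H}" using that assms(2) by (auto simp: mem_pm_iff)
    then have "\<bar>x\<bar> \<le> int H" by auto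
    then show ?thesis unfolding assms(3) by (auto simp: cent_def)
  qed
  then have "bij_betw ?d ?S (cent (a * b))"
    using zero_rect_card[OF assms(1)] by (intro bij_betw_centI) (auto simp: inj_on_def)
  with A(1) have "bij_betw (?d \<circ> (\<lambda>(i, j). A i j)) ({..<a} \<times> {..<b}) (cent (a * b))"
    by (rule bij_betw_trans)
  then have "bij_betw (\<lambda>(i, j). 2 * A i j) ({..<a} \<times> {..<b}) (cent (a * b))"
    by (simp add: o_def case_prod_unfold)
  then show ?thesis
    unfolding zero_rect_def using A(2,3)
    by (intro exI[of _ "\<lambda>i j. 2 * A i j"]) (simp add: sum_distrib_left[symmetric])
qed

lemma card_insert_0_pm:
  assumes "finite X" "0 \<notin> X"
  shows "card (insert 0 (pm X)) = 2 * card X + 1"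
proof -
  have "int ` X \<inter> (\<lambda>x. - int x) ` X = {}" using assms(2) by auto (metis int_zle_neg nat_int nle_le)
  then have "card (pm X) = card (int ` X) + card ((\<lambda>x. - int x) ` X)"
    unfolding pm_def using assms(1) by (intro card_Un_disjoint) auto
  also have "\<dots> = 2 * card X" by (simp add: card_image inj_on_def)
  finally have "card (pm X) = 2 * card X" .
  moreover have "finite (pm X)" using assms(1) by (simp add: pm_def)
  moreover have "0 \<notin> pm X" using assms(2) by (simp add: mem_pm_iff)
  ultimately show ?thesis by simp
qed

text \<open>In the cores below the column \<open>(d, - d, 0)\<close> is accompanied by pairs of columns
  \<open>(x, y, - x - y)\<close> and \<open>(- y, - x, x + y)\<close>, which contribute \<open>x - y\<close> and \<open>y - x\<close> to the first two
  row sums; the values are chosen such that these differences add up to \<open>- d\<close>.\<close>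

lemma core_3_3:
  assumes "2 \<le> c"
  shows "zero_rect 3 3 (insert 0 (pm {1, c, c + 1, c + 2}))"
proof (rule zero_rect_of_lists)
  let ?c = "int c"
  let ?L = "[[?c, 1, - ?c - 1], [- ?c, ?c + 1, - 1], [0, - ?c - 2, ?c + 2]]"
  show "length ?L = 3" by simp
  show "set (concat ?L) = insert 0 (pm {1, c, c + 1, c + 2})"
    by (auto simp: pm_def)
  show "card (insert 0 (pm {1, c, c + 1, c + 2})) = 3 * 3"
    using assms by (subst card_insert_0_pm) auto
  show "length r = 3" if "r \<in> set ?L" for r using that by auto
  show "sum_list r = 0" if "r \<in> set ?L" for r using that by auto
  show "sum_list (map (\<lambda>r. r ! j) ?L) = 0" if "j < 3" for j
  proof -
    have "j \<in> {0, 1, 2}" using that by auto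
    then show ?thesis by auto
  qed
qed

text \<open>Widening \<open>core_3_3\<close> fails here: inside \<open>{1..7}\<close> it leaves
  \<open>{5, 6, 7}\<close>, \<open>{2, 6, 7}\<close>, \<open>{2, 3, 7}\<close> or
  \<open>{2, 3, 4}\<close>, none of the form \<open>{d, P, P + d}\<close>.\<close>

lemma core_3_5: "zero_rect 3 5 (insert 0 (pm {1, 2, 3, 4, 5, 6, 7}))"
proof (rule zero_rect_of_lists)
  let ?L = "[[4, 1, - 6, 3, - 2], [- 4, 6, - 1, 2, - 3], [0, - 7, 7, - 5, 5]] :: int list list"
  show "length ?L = 3" by simp
  show "set (concat ?L) = insert 0 (pm {1, 2, 3, 4, 5, 6, 7})"
    by (auto simp: pm_def)
  show "card (insert 0 (pm {1, 2, 3, 4, 5, 6, 7})) = 3 * 5"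
    by (subst card_insert_0_pm) auto
  show "length r = 5" if "r \<in> set ?L" for r using that by auto
  show "sum_list r = 0" if "r \<in> set ?L" for r using that by auto
  show "sum_list (map (\<lambda>r. r ! j) ?L) = 0" if "j < 5" for j
  proof -
    have "j \<in> {0, 1, 2, 3, 4}" using that by auto
    then show ?thesis by auto
  qed
qed

text \<open>The values are the triples \<open>{1, q + 1, q + 2}\<close>,
  \<open>{2, c, c + 2}\<close>, \<open>{3, q, q + 3}\<close> and the single number
  \<open>c + 1\<close>, so that further triples can be added.\<close>

lemma core_3_7:
  assumes "4 \<le> c" "c + 2 < q"
  shows "zero_rect 3 7 (insert 0 (pm {1, 2, 3, c, c + 1, c + 2, q, q + 1, q + 2, q + 3}))"
proof (rule zero_rect_of_lists)
  let ?c = "int c" and ?q = "int q"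
  let ?L = "[[?c + 1, 3, - ?q, ?q + 1, - 1, - (?c + 2), - 2],
    [- (?c + 1), ?q, - 3, 1, - (?q + 1), 2, ?c + 2],
    [0, - (?q + 3), ?q + 3, - (?q + 2), ?q + 2, ?c, - ?c]]"
  show "length ?L = 3" by simp
  show "set (concat ?L) = insert 0 (pm {1, 2, 3, c, c + 1, c + 2, q, q + 1, q + 2, q + 3})"
    by (simp add: pm_def insert_commute add.commute)
  show "card (insert 0 (pm {1, 2, 3, c, c + 1, c + 2, q, q + 1, q + 2, q + 3})) = 3 * 7"
    using assms by (subst card_insert_0_pm) auto
  show "length r = 7" if "r \<in> set ?L" for r using that by auto
  show "sum_list r = 0" if "r \<in> set ?L" for r using that by auto
  show "sum_list (map (\<lambda>r. r ! j) ?L) = 0" if "j < 7" for j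
  proof -
    have "j \<in> {0, 1, 2, 3, 4, 5, 6}" using that by auto
    then show ?thesis by auto
  qed
qed

text \<open>The pairs of difference \<open>d = 1, \<dots>, M\<close> fill \<open>{M + 1..3 M + 1}\<close> except for one number: pairs with
  even \<open>d\<close> are nested around the omitted number \<open>M + M div 2 + 1\<close>, those with odd \<open>d\<close> around the
  midpoint of \<open>{2 M + M div 2 + 1, 2 M + M div 2 + 2}\<close>.\<close>

definition lo :: "nat \<Rightarrow> nat \<Rightarrow> nat" where
  "lo M d = (if even d then M else 2 * M) + M div 2 + 1 - d div 2"

definition pair :: "nat \<Rightarrow> nat \<Rightarrow> nat set" where
  "pair M d = {lo M d, lo M d + d}"

lemma pair_even: "2 * i \<le> M \<Longrightarrow> pair M (2 * i) = {M + M div 2 + 1 - i, M + M div 2 + 1 + i}"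
  by (simp add: pair_def lo_def add_ac)

lemma pair_odd: "2 * i + 1 \<le> M \<Longrightarrow> pair M (2 * i + 1) = {2 * M + M div 2 + 1 - i, 2 * M + M div 2 + 2 + i}"
  by (simp add: pair_def lo_def add_ac)

lemma pair_bounds:
  assumes "1 \<le> d" "d \<le> M" "x \<in> pair M d"
  shows "M < x" "x \<le> 3 * M + 1" "x \<noteq> M + M div 2 + 1"
proof -
  obtain i where i: "d = 2 * i \<or> d = 2 * i + 1" by (meson evenE oddE)
  \<comment> \<open>The sharper bound for odd \<open>d\<close> keeps the upper element at most
    \<open>3 * M + 1\<close>.\<close>
  then have "i \<le> M div 2" "d = 2 * i + 1 \<Longrightarrow> i + M div 2 + 1 \<le> M" using assms(2) by auto
  with i show "M < x" "x \<le> 3 * M + 1" "x \<noteq> M + M div 2 + 1"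
    using assms pair_even[of i M] pair_odd[of i M] by auto
qed

lemma pair_disjoint:
  assumes "1 \<le> d" "d \<le> M" "1 \<le> d'" "d' \<le> M" "d \<noteq> d'"
  shows "pair M d \<inter> pair M d' = {}"
proof -
  obtain i where i: "d = 2 * i \<or> d = 2 * i + 1" by (meson evenE oddE)
  obtain j where j: "d' = 2 * j \<or> d' = 2 * j + 1" by (meson evenE oddE)
  \<comment> \<open>The odd case gives \<open>i + j < M\<close> for differences of opposite parity,
    so even pairs lie entirely below odd ones.\<close>
  have bounds: "i \<le> M div 2" "j \<le> M div 2"
    "d = 2 * i + 1 \<Longrightarrow> i + M div 2 + 1 \<le> M" "d' = 2 * j + 1 \<Longrightarrow> j + M div 2 + 1 \<le> M"
    using i j assms by auto
  consider "d = 2 * i" "d' = 2 * j" | "d = 2 * i" "d' = 2 * j + 1"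
    | "d = 2 * i + 1" "d' = 2 * j" | "d = 2 * i + 1" "d' = 2 * j + 1" using i j by blast
  then show ?thesis
  proof cases
    case 1
    then show ?thesis using assms bounds pair_even[of i M] pair_even[of j M] by auto
  next
    case 2
    then show ?thesis using assms bounds pair_even[of i M] pair_odd[of j M] by auto
  next
    case 3
    then show ?thesis using assms bounds pair_odd[of i M] pair_even[of j M] by auto
  next
    case 4
    then show ?thesis using assms bounds pair_odd[of i M] pair_odd[of j M] by auto
  qed
qed

section \<open>Triples as building blocks\<close>

definition triple :: "nat \<Rightarrow> nat \<Rightarrow> nat set" where
  "triple M d = insert d (pair M d)"

lemma triple_bounds:
  assumes "1 \<le> d" "d \<le> M" "x \<in> triple M d"
  shows "1 \<le> x" "x \<le> 3 * M + 1" "x \<noteq> M + M div 2 + 1"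
  using assms pair_bounds[OF assms(1,2), of x] by (auto simp: triple_def)

lemma UN_triples_subset:
  assumes "1 \<le> k" "l \<le> M"
  shows "(\<Union>d\<in>{k..l}. triple M d) \<subseteq> {1..3 * M + 1} - {M + M div 2 + 1}"
proof (rule UN_least, rule subsetI)
  fix d x assume "d \<in> {k..l}" "x \<in> triple M d"
  then have "1 \<le> d" "d \<le> M" "x \<in> triple M d" using assms by auto
  from triple_bounds[OF this] show "x \<in> {1..3 * M + 1} - {M + M div 2 + 1}" by simp
qed

lemma triple_disjoint:
  assumes "1 \<le> d" "d \<le> M" "1 \<le> d'" "d' \<le> M" "d \<noteq> d'"
  shows "triple M d \<inter> triple M d' = {}"
proof -
  have "d \<notin> pair M d'" "d' \<notin> pair M d"
    using assms pair_bounds(1)[of d' M d] pair_bounds(1)[of d M d'] by auto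
  then show ?thesis using pair_disjoint[OF assms] assms(5) by (auto simp: triple_def)
qed

lemma balanced_parts_triples:
  assumes "1 \<le> k" "l \<le> M"
  shows "balanced_parts 3 (card {k..l}) (\<Union>d\<in>{k..l}. triple M d)"
proof (rule balanced_parts_UN)
  fix d assume "d \<in> {k..l}"
  then have "1 \<le> d" "d < lo M d" using assms pair_bounds(1)[of d M "lo M d"] by (auto simp: pair_def)
  then show "balanced 3 (triple M d)"
    using balanced_triple by (simp add: triple_def pair_def)
qed (use assms triple_disjoint in auto)

lemma balanced_parts_nonzero: "balanced_parts b k X \<Longrightarrow> 0 \<notin> X"
  by (induction rule: balanced_parts.induct) (auto simp: balanced_def)

lemma zero_rect_insert_0_add_strips:
  assumes "zero_rect a b (insert 0 (pm X))" "balanced_parts b k Y" "X \<inter> Y = {}"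
  shows "zero_rect (a + 2 * k) b (insert 0 (pm (X \<union> Y)))"
proof -
  have "insert 0 (pm X) \<inter> pm Y = {}"
    using assms(3) balanced_parts_nonzero[OF assms(2)] by (auto simp: mem_pm_iff)
  from zero_rect_add_strips[OF assms(2,1) this] show ?thesis by (simp add: pm_Un)
qed

text \<open>Transposition turns strips of two rows into strips of two columns.\<close>

lemma zero_rect_insert_0_widen:
  assumes "zero_rect a b (insert 0 (pm X))" "balanced_parts a k Y" "X \<inter> Y = {}"
  shows "zero_rect a (b + 2 * k) (insert 0 (pm (X \<union> Y)))"
  using assms zero_rect_insert_0_add_strips zero_rect_transpose by blast

text \<open>The core takes the triples of 1, 2, 3 and the omitted number; the others widen it.
  \<open>M\<close> may exceed \<open>n\<close>, leaving triples for strips.\<close>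

lemma zero_rect_triples:
  assumes "3 \<le> n" "n \<le> M"
  shows "zero_rect 3 (2 * n + 1) (insert 0 (pm (insert (M + M div 2 + 1) (\<Union>d\<in>{1..n}. triple M d))))"
proof -
  let ?c = "M + M div 2" and ?q = "2 * M + M div 2"
  let ?X = "{1, 2, 3, ?c, ?c + 1, ?c + 2, ?q, ?q + 1, ?q + 2, ?q + 3}" and ?Y = "\<Union>d\<in>{4..n}. triple M d"
  have three: "{1..3} = {1, 2, 3::nat}" by auto
  have X: "?X = insert (?c + 1) (\<Union>d\<in>{1..3}. triple M d)"
    unfolding three by (auto simp: triple_def pair_def lo_def)
  have "triple M d \<inter> triple M d' = {}" if "d \<in> {1..3}" "d' \<in> {4..n}" for d d'
    using that assms by (intro triple_disjoint) auto
  moreover have "?c + 1 \<notin> ?Y" using UN_triples_subset[of 4 n M] assms(2) by auto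
  ultimately have disj: "?X \<inter> ?Y = {}" unfolding X by blast
  have "balanced_parts 3 (card {4..n}) ?Y"
    using assms(2) by (intro balanced_parts_triples) simp_all
  moreover have "zero_rect 3 7 (insert 0 (pm ?X))" using assms by (intro core_3_7) auto
  ultimately have "zero_rect 3 (7 + 2 * card {4..n}) (insert 0 (pm (?X \<union> ?Y)))"
    using disj by (intro zero_rect_insert_0_widen)
  moreover have "{1..n} = {1..3} \<union> {4..n}" using assms by auto
  then have "?X \<union> ?Y = insert (?c + 1) (\<Union>d\<in>{1..n}. triple M d)"
    unfolding X by auto
  moreover have "7 + 2 * card {4..n} = 2 * n + 1" using assms(1) by simp
  ultimately show ?thesis by (simp only:)
qed

lemma balanced_parts_extend_interval:
  assumes "balanced_parts b k X" "0 < s" "X \<inter> {s..<s + 4 * q * k} = {}"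
  shows "balanced_parts (b + 4 * q) k (X \<union> {s..<s + 4 * q * k})"
  using balanced_parts_extend[of b k X 1 s 0 q] assms by simp

text \<open>For odd \<open>n\<close> the width is \<open>3 + 4 * q\<close>, so each strip is a
  triple and \<open>q\<close> quadruples. Of the \<open>M = n + (m - 1)\<close> triples,
  \<open>n\<close> build the first three rows and \<open>m - 1\<close> start the strips; the
  quadruples come from above \<open>3 * M + 1\<close>.\<close>

lemma zero_rect_odd_quads:
  assumes "3 \<le> n" "odd n" "1 \<le> m"
  shows "\<exists>X\<subseteq>{1..2 * m * n + m + n}. zero_rect (2 * m + 1) (2 * n + 1) (insert 0 (pm X))"
proof -
  define M q where "M = m + n - 1" and "q = n div 2"
  have n: "n = 2 * q + 1" using assms(2) by (simp add: q_def)
  let ?X = "insert (M + M div 2 + 1) (\<Union>d\<in>{1..n}. triple M d)"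
  let ?T = "\<Union>d\<in>{n + 1..M}. triple M d" and ?s = "3 * M + 2"
  let ?I = "{?s..<?s + 4 * q * (m - 1)}"
  have card: "card {n + 1..M} = m - 1" using assms by (simp add: M_def)
  have "n \<le> M" using assms(3) by (simp add: M_def)
  have "M + M div 2 + 1 \<le> 3 * M + 1" by simp
  then have X: "?X \<subseteq> {1..3 * M + 1}" using UN_triples_subset[of 1 n M] \<open>n \<le> M\<close> by auto
  have T: "?T \<subseteq> {1..3 * M + 1}" "M + M div 2 + 1 \<notin> ?T"
    using UN_triples_subset[of "n + 1" M M] by auto
  have "triple M d \<inter> triple M d' = {}" if "d \<in> {1..n}" "d' \<in> {n + 1..M}" for d d'
    using that by (intro triple_disjoint) auto
  then have "?X \<inter> ?T = {}" using T(2) by blast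
  moreover have "?I \<inter> {1..3 * M + 1} = {}" by auto
  then have XI: "?X \<inter> ?I = {}" and TI: "?T \<inter> ?I = {}" using X T(1) by blast+
  ultimately have disj: "?X \<inter> (?T \<union> ?I) = {}" by blast
  have "balanced_parts (3 + 4 * q) (m - 1) (?T \<union> ?I)"
    using balanced_parts_triples[of "n + 1" M M] TI unfolding card
    by (intro balanced_parts_extend_interval) simp_all
  moreover have "3 + 4 * q = 2 * n + 1" by (simp add: n)
  ultimately have strips: "balanced_parts (2 * n + 1) (m - 1) (?T \<union> ?I)"
    by (simp only:)
  have "zero_rect (3 + 2 * (m - 1)) (2 * n + 1) (insert 0 (pm (?X \<union> (?T \<union> ?I))))"
    using zero_rect_triples[OF assms(1) \<open>n \<le> M\<close>] strips disj by (rule zero_rect_insert_0_add_strips)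
  moreover have "3 + 2 * (m - 1) = 2 * m + 1" using assms by simp
  ultimately have "zero_rect (2 * m + 1) (2 * n + 1) (insert 0 (pm (?X \<union> (?T \<union> ?I))))"
    by (simp only:)
  moreover have "?X \<union> (?T \<union> ?I) \<subseteq> {1..2 * m * n + m + n}"
  proof -
    have "3 * M + 1 + 4 * q * (m - 1) = 2 * m * n + m + n"
      using assms(3) by (cases m) (simp_all add: M_def n algebra_simps)
    then have "{1..3 * M + 1} \<union> ?I \<subseteq> {1..2 * m * n + m + n}" by auto
    then show ?thesis using X T(1) by blast
  qed
  ultimately show ?thesis by (intro exI conjI)
qed

text \<open>With three rows there are no strips, so \<open>M = n\<close> works for either parity of
  \<open>n\<close>.\<close>

lemma zero_rect_3:
  assumes "3 \<le> n"
  shows "\<exists>X\<subseteq>{1..3 * n + 1}. zero_rect 3 (2 * n + 1) (insert 0 (pm X))"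
proof (intro exI conjI)
  show "zero_rect 3 (2 * n + 1) (insert 0 (pm (insert (n + n div 2 + 1) (\<Union>d\<in>{1..n}. triple n d))))"
    using zero_rect_triples[OF assms] by simp
  show "insert (n + n div 2 + 1) (\<Union>d\<in>{1..n}. triple n d) \<subseteq> {1..3 * n + 1}"
    using UN_triples_subset[of 1 n n] by auto
qed

text \<open>For sides \<open>2 m + 1\<close> and \<open>2 n + 1\<close> with \<open>m\<close> and \<open>n\<close> even, strips have length \<open>2 n + 1 = 5 + 4 q\<close>. A quintuple combines
  \<open>d\<close> with a pair of difference \<open>d - 1\<close> or \<open>d + 1\<close> and a pair of difference \<open>1\<close>; the differences are
  exchanged within \<open>{1, 2}, {3, 4}, \<dots>\<close>. The number \<open>1\<close> itself is left for the \<open>3 \<times> 3\<close> core, which takes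
  over the pair of difference \<open>2\<close> and the number in its middle.\<close>

definition partner :: "nat \<Rightarrow> nat" where
  "partner d = (if even d then d - 1 else d + 1)"

text \<open>The pairs of difference 1 are stacked from \<open>3 * M + 2\<close> on, above all values
  of \<open>pair\<close>; \<open>d = 2\<close> gets the first.\<close>

definition quintuple :: "nat \<Rightarrow> nat \<Rightarrow> nat set" where
  "quintuple M d = {d, 3 * M + 2 + 2 * (d - 2), 3 * M + 2 + 2 * (d - 2) + 1} \<union> pair M (partner d)"

text \<open>The difference of 1 between \<open>d\<close> and its partner is offset by
  \<open>w\<close> and \<open>w + 1\<close>, on sides chosen by the parity of
  \<open>d\<close>.\<close>

lemma balanced_quintuple:
  assumes "2 \<le> d" "d \<le> M" "partner d \<le> M"
  shows "balanced 5 (quintuple M d)"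
proof -
  define p w where "p = partner d" and "w = 3 * M + 2 + 2 * (d - 2)"
  have p: "1 \<le> p" "p \<le> M" using assms by (auto simp: p_def partner_def)
  have lo: "M < lo M p" "lo M p + p \<le> 3 * M + 1"
    using pair_bounds[OF p] by (auto simp: pair_def)
  have w: "3 * M + 2 \<le> w" by (simp add: w_def)
  have Q: "quintuple M d = {d, lo M p, lo M p + p, w, w + 1}"
    by (auto simp: quintuple_def pair_def p_def w_def)
  have card: "card {d, lo M p, lo M p + p, w, w + 1} = 5"
    using assms p lo w by auto
  have "\<exists>Z\<subseteq>{d, lo M p, lo M p + p, w, w + 1}. \<Sum>Z = \<Sum>({d, lo M p, lo M p + p, w, w + 1} - Z)"
  proof (cases "even d")
    case True
    then have d: "d = p + 1" using assms by (simp add: p_def partner_def)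
    have "{d, lo M p, lo M p + p, w, w + 1} - {d, lo M p, w} = {lo M p + p, w + 1}"
      using assms p lo w by auto
    then show ?thesis using assms p lo w d by (intro exI[of _ "{d, lo M p, w}"]) auto
  next
    case False
    then have d: "p = d + 1" using assms by (simp add: p_def partner_def)
    have "{d, lo M p, lo M p + p, w, w + 1} - {d, lo M p, w + 1} = {lo M p + p, w}"
      using assms p lo w by auto
    then show ?thesis using assms p lo w d by (intro exI[of _ "{d, lo M p, w + 1}"]) auto
  qed
  then show ?thesis
    using assms p lo w card unfolding Q balanced_def by simp
qed

text \<open>The \<open>n - 1\<close> triples with \<open>d > m\<close> widen the core to
  \<open>2 * n + 1\<close> columns; the \<open>m - 1\<close> quintuples with
  \<open>2 \<le> d \<le> m\<close>, extended by quadruples, give the other rows.\<close>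

lemma zero_rect_odd_both_even:
  assumes "even m" "even n" "2 \<le> m" "2 \<le> n"
  shows "\<exists>X\<subseteq>{1..2 * m * n + m + n}. zero_rect (2 * m + 1) (2 * n + 1) (insert 0 (pm X))"
proof -
  define M q where "M = m + n - 1" and "q = n div 2 - 1"
  let ?c = "M + M div 2"
  have n: "n = 2 * q + 2" using assms(2,4) unfolding q_def by auto
  let ?C = "{1, ?c, ?c + 1, ?c + 2}" and ?T = "\<Union>d\<in>{m + 1..M}. triple M d"
  let ?F = "\<Union>d\<in>{2..m}. quintuple M d" and ?s = "3 * M + 2 + 2 * (m - 1)"
  let ?I = "{?s..<?s + 4 * q * (m - 1)}"
  have M: "3 \<le> M" "m < M" using assms by (auto simp: M_def)
  \<comment> \<open>As \<open>m\<close> is even, the exchange stays within \<open>{1..m}\<close>.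
    Pair 2 would be the partner of 1 only, so it is free for the core.\<close>
  have partner: "partner d \<in> {1} \<union> {3..m}" if "d \<in> {2..m}" for d
  proof (cases "even d")
    case True
    then have "d = 2 \<or> 4 \<le> d" using that by (cases "d = 3") auto
    then show ?thesis using that True by (auto simp: partner_def)
  next
    case False
    then have "d \<noteq> m" using assms(1) by auto
    then show ?thesis using that False by (auto simp: partner_def)
  qed
  have partner_inj: "partner d \<noteq> partner d'" if "2 \<le> d" "2 \<le> d'" "d \<noteq> d'" for d d'
    using that unfolding partner_def by presburger
  have pairs: "pair M (partner d) \<subseteq> {M + 1..3 * M + 1}" if "d \<in> {2..m}" for d
    using pair_bounds[of "partner d" M] partner[OF that] M by fastforce
  have pair2: "pair M 2 = {?c, ?c + 2}" using M by (auto simp: pair_def lo_def)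
  have core_triples: "?C \<inter> triple M d = {}" if "d \<in> {m + 1..M}" for d
  proof -
    have "pair M 2 \<inter> triple M d = {}" "1 \<notin> triple M d" "?c + 1 \<notin> triple M d"
      using triple_disjoint[of 2 M d] triple_disjoint[of 1 M d] triple_bounds(3)[of d M] assms(3) that M
      by (auto simp: triple_def)
    then show ?thesis unfolding pair2 by auto
  qed
  have core_quintuples: "?C \<inter> quintuple M d = {}" if "d \<in> {2..m}" for d
  proof -
    have p: "1 \<le> partner d" "partner d \<le> M" "partner d \<noteq> 2"
      using partner[OF that] M by auto
    have "pair M 2 \<inter> pair M (partner d) = {}" "?c + 1 \<notin> pair M (partner d)"
      using pair_disjoint[of 2 M "partner d"] pair_bounds(3)[OF p(1,2)] p M by auto
    moreover have "1 \<notin> pair M (partner d)" using pairs[OF that] M by auto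
    moreover have "?c + 2 < 3 * M + 2" "m < ?c" using M by auto
    ultimately show ?thesis using that M unfolding pair2 by (auto simp: quintuple_def)
  qed
  have triple_quintuple: "triple M d \<inter> quintuple M d' = {}" if "d \<in> {m + 1..M}" "d' \<in> {2..m}" for d d'
  proof -
    have p: "1 \<le> partner d'" "partner d' \<le> m" using partner[OF that(2)] assms(3) by auto
    then have "pair M d \<inter> pair M (partner d') = {}"
      using pair_disjoint[of d M "partner d'"] that M by auto
    moreover have "d \<notin> pair M (partner d')" using pairs[OF that(2)] that(1) by auto
    moreover have "x \<in> {M + 1..3 * M + 1}" if "x \<in> pair M d" for x
      using pair_bounds[of d M x] that \<open>d \<in> _\<close> by auto
    ultimately show ?thesis using that M by (fastforce simp: triple_def quintuple_def)
  qed
  have quintuples: "quintuple M d \<inter> quintuple M d' = {}" if "d \<in> {2..m}" "d' \<in> {2..m}" "d \<noteq> d'" for d d'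
  proof -
    have "pair M (partner d) \<inter> pair M (partner d') = {}"
      using partner[OF that(1)] partner[OF that(2)] partner_inj[of d d'] that M
      by (intro pair_disjoint) auto
    moreover have "3 * M + 2 + 2 * (d - 2) \<noteq> 3 * M + 2 + 2 * (d' - 2)" using that by auto
    moreover have "d \<le> m" "d' \<le> m" using that by auto
    ultimately show ?thesis
      using pairs[OF that(1)] pairs[OF that(2)] that(3) M by (fastforce simp: quintuple_def)
  qed
  have C: "?C \<subseteq> {1..3 * M + 1}" using M by auto
  have T: "?T \<subseteq> {1..3 * M + 1}" using UN_triples_subset[of "m + 1" M M] by auto
  have "quintuple M d \<subseteq> {1..<?s}" if "d \<in> {2..m}" for d
  proof -
    have "{M + 1..3 * M + 1} \<subseteq> {1..<?s}" by auto
    then have "pair M (partner d) \<subseteq> {1..<?s}" using pairs[OF that] by blast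
    then show ?thesis using that M by (auto simp: quintuple_def)
  qed
  then have F: "?F \<subseteq> {1..<?s}" by blast
  have "?C \<inter> ?T = {}" using core_triples by blast
  moreover have "balanced_parts 3 (n - 1) ?T"
    using balanced_parts_triples[of "m + 1" M M] assms(3) by (simp add: M_def)
  moreover have "zero_rect 3 3 (insert 0 (pm ?C))" using M by (intro core_3_3) simp
  ultimately have "zero_rect 3 (3 + 2 * (n - 1)) (insert 0 (pm (?C \<union> ?T)))"
    by (intro zero_rect_insert_0_widen)
  moreover have "3 + 2 * (n - 1) = 2 * n + 1" using assms(4) by simp
  ultimately have wide: "zero_rect 3 (2 * n + 1) (insert 0 (pm (?C \<union> ?T)))"
    by (simp only:)
  have "balanced_parts 5 (card {2..m}) ?F"
  proof (rule balanced_parts_UN)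
    show "balanced 5 (quintuple M d)" if "d \<in> {2..m}" for d
      using that partner[OF that] M by (intro balanced_quintuple) auto
  qed (use quintuples in auto)
  moreover have "?I \<inter> {1..<?s} = {}" by auto
  then have "?F \<inter> ?I = {}" using F by blast
  moreover have "card {2..m} = m - 1" by simp
  ultimately have "balanced_parts (5 + 4 * q) (m - 1) (?F \<union> ?I)"
    by (intro balanced_parts_extend_interval) simp_all
  moreover have "5 + 4 * q = 2 * n + 1" by (simp add: n)
  ultimately have strips: "balanced_parts (2 * n + 1) (m - 1) (?F \<union> ?I)"
    by (simp only:)
  have "(?C \<union> ?T) \<inter> ?F = {}" using core_quintuples triple_quintuple by blast
  moreover have "?I \<inter> {1..3 * M + 1} = {}" by auto
  then have "(?C \<union> ?T) \<inter> ?I = {}" using C T by blast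
  ultimately have "(?C \<union> ?T) \<inter> (?F \<union> ?I) = {}" by (simp only: Int_Un_distrib Un_empty)
  with wide strips
  have "zero_rect (3 + 2 * (m - 1)) (2 * n + 1) (insert 0 (pm ((?C \<union> ?T) \<union> (?F \<union> ?I))))"
    by (rule zero_rect_insert_0_add_strips)
  moreover have "3 + 2 * (m - 1) = 2 * m + 1" using assms by simp
  ultimately have "zero_rect (2 * m + 1) (2 * n + 1) (insert 0 (pm ((?C \<union> ?T) \<union> (?F \<union> ?I))))"
    by (simp only:)
  moreover have "(?C \<union> ?T) \<union> (?F \<union> ?I) \<subseteq> {1..2 * m * n + m + n}"
  proof -
    define K t where "K = 2 * m * n + m + n" and "t = 4 * q * (m - 1)"
    have "?s + t = K + 1"
      using assms(3) by (cases m) (simp_all add: M_def K_def t_def n algebra_simps)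
    then have "{?s..<?s + t} \<subseteq> {1..K}" "{1..3 * M + 1} \<subseteq> {1..K}" "{1..<?s} \<subseteq> {1..K}"
      by auto
    then show ?thesis using C T F unfolding K_def t_def by blast
  qed
  ultimately show ?thesis by (intro exI conjI)
qed

lemma zero_rect_odd:
  assumes "odd a" "odd b" "3 \<le> a" "3 \<le> b"
  shows "zero_rect a b (cent (a * b))"
proof -
  \<comment> \<open>The bound is \<open>(a * b - 1) / 2\<close> for \<open>a = 2 * m + 1\<close>,
    \<open>b = 2 * n + 1\<close>. Being symmetric in \<open>m\<close> and \<open>n\<close>,
    \<open>good\<close> lets an odd parameter be moved to the second place.\<close>
  define good where "good m n \<longleftrightarrow>
    (\<exists>X\<subseteq>{1..2 * m * n + m + n}. zero_rect (2 * m + 1) (2 * n + 1) (insert 0 (pm X)))" for m n :: nat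
  have good_sym: "good m n" if "good n m" for m n
    using that zero_rect_transpose unfolding good_def by (auto simp: ac_simps)
  have good_1: "good 1 n" if "1 \<le> n" for n
  proof -
    have "n = 1 \<or> n = 2 \<or> 3 \<le> n" using that by linarith
    moreover have "good 1 1"
      using core_3_3[of 2] unfolding good_def by (intro exI[of _ "{1, 2, 3, 4}"]) auto
    moreover have "good 1 2"
      using core_3_5 unfolding good_def by (intro exI[of _ "{1, 2, 3, 4, 5, 6, 7}"]) auto
    moreover have "good 1 n" if "3 \<le> n"
      using zero_rect_3[OF that] by (simp add: good_def)
    ultimately show ?thesis by blast
  qed
  have good_odd: "good m n" if "1 \<le> m" "1 \<le> n" "odd n" for m n
  proof (cases "n = 1")
    case True
    then show ?thesis using good_1[OF that(1)] good_sym by simp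
  next
    case False
    then have "3 \<le> n" using that by presburger
    then show ?thesis using zero_rect_odd_quads that unfolding good_def by blast
  qed
  have good: "good m n" if "1 \<le> m" "1 \<le> n" for m n
  proof -
    consider "odd n" | "odd m" | "even m" "even n" by blast
    then show ?thesis
    proof cases
      case 1
      then show ?thesis using good_odd that by blast
    next
      case 2
      then show ?thesis using good_odd good_sym that by blast
    next
      case 3
      then have "2 \<le> m" "2 \<le> n" using that by presburger+
      then show ?thesis using zero_rect_odd_both_even 3 unfolding good_def by blast
    qed
  qed
  obtain m n where mn: "a = 2 * m + 1" "b = 2 * n + 1" using assms(1,2) by (auto elim!: oddE)
  then have "good m n" using assms(3,4) by (intro good) auto
  then obtain X where X: "X \<subseteq> {1..2 * m * n + m + n}" "zero_rect a b (insert 0 (pm X))"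
    unfolding good_def mn by blast
  show ?thesis
    by (rule zero_rect_cent_odd[OF X(2,1)]) (simp add: mn algebra_simps)
qed

theorem theorem13:
  fixes a b c :: nat
  assumes "0 < a" and "0 < b" and "0 < c"
    and "2 \<le> a" and "a \<le> b"
    and "(odd a \<and> odd b \<and> odd c) \<or> (even a \<and> even b \<and> (a, b) \<noteq> (2, 2))"
  shows "\<exists>A. magic_rectangle (a * c) (b * c) b a A"
proof (rule magic_rectangle_of_kernel)
  from assms(6) have "zero_rect a b (cent (a * b)) \<and> zero_kernel a b c"
  proof
    assume *: "odd a \<and> odd b \<and> odd c"
    then have "a \<noteq> 2" by auto
    then have "3 \<le> a" "3 \<le> b" using assms(4,5) by auto
    with * show ?thesis by (simp add: zero_rect_odd zero_kernel_odd)
  next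
    assume "even a \<and> even b \<and> (a, b) \<noteq> (2, 2)"
    then show ?thesis using assms(4,5) zero_rect_even zero_kernel_even by blast
  qed
  then show "zero_rect a b (cent (a * b))" "zero_kernel a b c" by blast+
qed (fact assms)+

end
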